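(* Let $c=(C_n)_{n\ge 0}$ be the Catalan sequence in the Banach algebra $\ell^1(\mathbb{N}^0,\frac1{4^n})$. Then $c$ is invertible with inverse $c^{-1}=\delta_0-\delta_1\ast c$. Moreover, for every $\lambda\in\mathbb{C}\setminus\{0\}$ with $\left|\frac{\lambda-1}{\lambda^2}\right|>\frac14$, the element $\lambda\delta_0-c$ is invertible in $\ell^1(\mathbb{N}^0,\frac1{4^n})$ and $$(\lambda-c)^{-1}=\frac{\delta_0}{\lambda}+\frac{1}{\lambda(\lambda-1)}\,p_{\frac{\lambda-1}{\lambda^2}}+\frac{1}{\lambda^2}\,c-\frac{1}{\lambda^2}\,c\ast p_{\frac{\lambda-1}{\lambda^2}}.$$
   Context: The Catalan numbers are $C_n=\frac{1}{n+1}\binom{2n}{n}$, $n\ge 0$. The algebra $\ell^1(\mathbb{N}^0,\frac1{4^n})$ consists of the complex sequences $a=(a_n)_{n\ge0}$ with $\|a\|_{1,\frac1{4^n}}:=\sum_{n\ge0}\frac{|a_n|}{4^n}<\infty$, with the convolution product $(a\ast b)_n=\sum_{j=0}^n a_{n-j}b_j$; the sequence $\delta_j$ is $1$ at index $j$ and $0$ elsewhere, and $\delta_0$ is the identity. The Catalan sequence belongs to this algebra. $(\lambda-c)^{-1}$ denotes the inverse of $\lambda\delta_0-c$. For $\mu\in\mathbb{C}\setminus\{0\}$, $p_\mu:=\left(\frac{1}{\mu^n}\right)_{n\ge0}$, which belongs to $\ell^1(\mathbb{N}^0,\frac1{4^n})$ if and only if $|\mu|>\frac14$. *)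

theory Defs
  imports "HOL-Analysis.Analysis" "HOL-Algebra.Module"
begin

definition conv :: "(nat \<Rightarrow> complex) \<Rightarrow> (nat \<Rightarrow> complex) \<Rightarrow> nat \<Rightarrow> complex"
  where "conv a b = (\<lambda>n. \<Sum>j=0..n. a (n - j) * b j)"

definition delta :: "nat \<Rightarrow> nat \<Rightarrow> complex"
  where "delta j = (\<lambda>n. if n = j then 1 else 0)"

text \<open>
  The algebra of sequences with finite weighted norm \<open>(\<Sum>n. norm (a n) / 4 ^ n)\<close>.
  Finiteness of the norm has to be expressed by \<open>summable\<close>, since \<open>suminf\<close> is total.
  Invertibility and inverses in the Banach algebra are those of its multiplicative monoid, i.e.
  \<open>Units\<close> and \<open>m_inv\<close>, so in particular the inverse is required to have finite norm as well.
\<close>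

definition l1_quarter :: "(complex, nat \<Rightarrow> complex) module"
  where "l1_quarter =
    \<lparr>carrier = {a. summable (\<lambda>n. norm (a n) / 4 ^ n)},
     mult = conv,
     one = delta 0,
     zero = (\<lambda>n. 0),
     add = (\<lambda>a b n. a n + b n),
     smult = (\<lambda>z a n. z * a n)\<rparr>"

definition catalan :: "nat \<Rightarrow> complex"
  where "catalan n = of_nat ((2 * n) choose n) / of_nat (n + 1)"

definition p_seq :: "complex \<Rightarrow> nat \<Rightarrow> complex"
  where "p_seq \<mu> = (\<lambda>n. 1 / \<mu> ^ n)"

lemma l1_quarter_simps:
  "a \<in> carrier l1_quarter \<longleftrightarrow> summable (\<lambda>n. norm (a n) / 4 ^ n)"
  "a \<otimes>\<^bsub>l1_quarter\<^esub> b = conv a b"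
  "\<one>\<^bsub>l1_quarter\<^esub> = delta 0"
  "\<zero>\<^bsub>l1_quarter\<^esub> = (\<lambda>n. 0)"
  "a \<oplus>\<^bsub>l1_quarter\<^esub> b = (\<lambda>n. a n + b n)"
  "z \<odot>\<^bsub>l1_quarter\<^esub> a = (\<lambda>n. z * a n)"
  by (simp_all add: l1_quarter_def)

lemma Abs_fps_conv: "Abs_fps (conv a b) = Abs_fps a * Abs_fps b"
  by (simp add: mult.commute[of "Abs_fps a"] fps_eq_iff fps_mult_nth conv_def)
    (simp add: mult.commute)

lemma Abs_fps_delta_0: "Abs_fps (delta 0) = 1"
  by (simp add: fps_eq_iff delta_def)

lemma Abs_fps_inject': "a = b \<longleftrightarrow> Abs_fps a = Abs_fps b"
  by (simp add: fps_eq_iff fun_eq_iff)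

lemma delta_in_l1: "delta j \<in> carrier l1_quarter"
  unfolding l1_quarter_simps
  by (rule summable_finite[of "{j}"]) (auto simp: delta_def)

lemma conv_in_l1:
  assumes "a \<in> carrier l1_quarter" "b \<in> carrier l1_quarter"
  shows "conv a b \<in> carrier l1_quarter"
  unfolding l1_quarter_simps
proof (rule summable_comparison_test'[where N = 0])
  let ?a = "\<lambda>n. norm (a n) / 4 ^ n" and ?b = "\<lambda>n. norm (b n) / 4 ^ n"
  show "summable (\<lambda>k. \<Sum>i\<le>k. ?b i * ?a (k - i))"
    using assms by (intro summable_Cauchy_product) (simp_all add: l1_quarter_simps)
  fix n :: nat
  have "norm (conv a b n) / 4 ^ n \<le> (\<Sum>i\<le>n. norm (a (n - i) * b i)) / 4 ^ n"
    unfolding conv_def atMost_atLeast0 by (intro divide_right_mono norm_sum) simp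
  also have "\<dots> = (\<Sum>i\<le>n. ?b i * ?a (n - i))"
    unfolding sum_divide_distrib
    by (intro sum.cong refl) (simp add: norm_mult flip: power_add)
  finally show "norm (norm (conv a b n) / 4 ^ n) \<le> (\<Sum>i\<le>n. ?b i * ?a (n - i))"
    by simp
qed

lemma add_in_l1:
  assumes "a \<in> carrier l1_quarter" "b \<in> carrier l1_quarter"
  shows "(\<lambda>n. a n + b n) \<in> carrier l1_quarter"
  unfolding l1_quarter_simps
proof (rule summable_comparison_test'[where N = 0])
  show "summable (\<lambda>n. norm (a n) / 4 ^ n + norm (b n) / 4 ^ n)"
    using assms by (intro summable_add) (simp_all add: l1_quarter_simps)
  show "norm (norm (a n + b n) / 4 ^ n) \<le> norm (a n) / 4 ^ n + norm (b n) / 4 ^ n" for n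
    by (simp add: norm_triangle_ineq divide_right_mono flip: add_divide_distrib)
qed

lemma smult_in_l1:
  assumes "a \<in> carrier l1_quarter"
  shows "(\<lambda>n. z * a n) \<in> carrier l1_quarter"
  using summable_mult[of "\<lambda>n. norm (a n) / 4 ^ n" "norm z"] assms
  by (simp add: l1_quarter_simps norm_mult)

lemma cring_l1_quarter: "cring l1_quarter"
proof (rule cringI)
  show "abelian_group l1_quarter"
  proof (rule abelian_groupI)
    fix a assume "a \<in> carrier l1_quarter"
    then have "(\<lambda>n. - 1 * a n) \<in> carrier l1_quarter" by (rule smult_in_l1)
    then show "\<exists>b\<in>carrier l1_quarter. b \<oplus>\<^bsub>l1_quarter\<^esub> a = \<zero>\<^bsub>l1_quarter\<^esub>"
      by (intro bexI) (auto simp: l1_quarter_simps(4,5))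
  next
    show "\<zero>\<^bsub>l1_quarter\<^esub> \<in> carrier l1_quarter"
      by (simp add: l1_quarter_simps(1,4))
  qed (simp_all add: add_in_l1 l1_quarter_simps(2-) add_ac)
  show "Group.comm_monoid l1_quarter"
    by (rule comm_monoidI)
      (simp_all add: conv_in_l1 delta_in_l1 l1_quarter_simps(2-) Abs_fps_inject' Abs_fps_conv
        Abs_fps_delta_0 mult_ac)
qed (simp add: l1_quarter_simps(2-) conv_def fun_eq_iff ring_distribs sum.distrib)

lemma minus_l1_quarter:
  assumes "a \<in> carrier l1_quarter" "b \<in> carrier l1_quarter"
  shows "a \<ominus>\<^bsub>l1_quarter\<^esub> b = (\<lambda>n. a n - b n)"
proof -
  interpret cring l1_quarter by (rule cring_l1_quarter)
  have b': "(\<lambda>n. - 1 * b n) \<in> carrier l1_quarter" using assms(2) by (rule smult_in_l1)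
  have "\<ominus>\<^bsub>l1_quarter\<^esub> b = (\<lambda>n. - 1 * b n)"
    by (rule minus_equality[OF _ assms(2) b']) (simp add: l1_quarter_simps(4,5))
  then show ?thesis by (simp add: a_minus_def l1_quarter_simps(5))
qed

end

theory Submission
  imports Defs
begin

text \<open>
  Writing \<open>C\<close> for the generating function of the Catalan numbers and \<open>D = 1 - 2 X C\<close>, the recurrence
  \<open>(n + 2) C\<^bsub>n+1\<^esub> = 2 (2 n + 1) C\<^bsub>n\<^esub>\<close> becomes \<open>(1 - 4 X) D' = - 2 D\<close>. Hence \<open>D\<^sup>2 / (1 - 4 X)\<close> has
  derivative \<open>0\<close>, so \<open>D\<^sup>2 = 1 - 4 X\<close>, which is the quadratic equation \<open>C = 1 + X C\<^sup>2\<close>. Both inverses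
  are then identities of formal power series: \<open>C (1 - X C) = 1\<close>, and, with \<open>\<mu> = (z - 1) / z\<^sup>2\<close>,
  \<open>(z - C) (1 - z X - X C) = (z - 1) (1 - X / \<mu>)\<close>, where \<open>1 - X / \<mu>\<close> is the inverse of the
  generating function of \<open>p\<^bsub>\<mu>\<^esub>\<close>. The Catalan sequence has finite norm because, with
  \<open>b\<^bsub>n\<^esub>\<close> the central binomial coefficient, \<open>C\<^bsub>n\<^esub> / 4\<^sup>n = 2 (b\<^bsub>n\<^esub> / 4\<^sup>n - b\<^bsub>n+1\<^esub> / 4\<^sup>n\<^sup>+\<^sup>1)\<close> telescopes.
\<close>

text \<open>Absorption is applied in row 2n+2 and then in row 2n+1; in between, symmetry exchanges
  the two middle entries of row 2n+1.\<close>

lemma central_binomial_Suc: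
  "(n + 1) * ((2 * Suc n) choose Suc n) = 2 * (2 * n + 1) * ((2 * n) choose n)"
proof -
  have "Suc n * (Suc (2 * n + 1) choose Suc n) = Suc (2 * n + 1) * ((2 * n + 1) choose n)"
    by (rule Suc_times_binomial)
  also have "\<dots> = 2 * (Suc n * ((2 * n + 1) choose n))"
    by (simp del: binomial_Suc_Suc)
  also have "(2 * n + 1) choose n = Suc (2 * n) choose Suc n"
    by (subst binomial_symmetric) simp_all
  also have "Suc n * (Suc (2 * n) choose Suc n) = Suc (2 * n) * ((2 * n) choose n)"
    by (rule Suc_times_binomial)
  finally show ?thesis by (simp del: binomial_Suc_Suc)
qed

lemma catalan_Suc:
  "of_nat (n + 2) * catalan (Suc n) = 2 * (2 * of_nat n + 1) * catalan n"
proof -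
  have "of_nat (n + 1) * of_nat ((2 * Suc n) choose Suc n) =
      (2 * (2 * of_nat n + 1) * of_nat ((2 * n) choose n) :: complex)"
    using arg_cong[OF central_binomial_Suc[of n], of "of_nat :: nat \<Rightarrow> complex"]
    by (simp only: of_nat_mult of_nat_add of_nat_numeral of_nat_1)
  moreover have "of_nat (n + 1) \<noteq> (0 :: complex)" "of_nat (n + 2) \<noteq> (0 :: complex)"
    by (simp_all only: of_nat_eq_0_iff)
  moreover have "of_nat (n + 2) * catalan (Suc n) = of_nat ((2 * Suc n) choose Suc n)"
    using calculation(3) unfolding catalan_def by (simp del: of_nat_add binomial_Suc_Suc)
  ultimately show ?thesis
    unfolding catalan_def by (simp add: field_simps del: binomial_Suc_Suc)
qed

text \<open>For consecutive central binomial coefficients b and b', the recurrence gives b'/4 = b -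
  b/(2(n+1)), and b/(n+1) is the Catalan number.\<close>

lemma catalan_telescope:
  "norm (catalan n) / 4 ^ n =
    2 * (real ((2 * n) choose n) / 4 ^ n - real ((2 * Suc n) choose Suc n) / 4 ^ Suc n)"
proof -
  define b b' where "b = real ((2 * n) choose n)" and "b' = real ((2 * Suc n) choose Suc n)"
  have c: "norm (catalan n) = b / real (n + 1)"
    unfolding catalan_def b_def norm_divide norm_of_nat ..
  have "real (n + 1) * b' = 2 * (2 * real n + 1) * b"
    using arg_cong[OF central_binomial_Suc[of n], of real] unfolding b_def b'_def
    by (simp only: of_nat_mult of_nat_add of_nat_numeral of_nat_1)
  then have b': "b' = 2 * (2 * real n + 1) * b / real (n + 1)"
    by (subst eq_divide_eq) (simp add: mult.commute)
  have "norm (catalan n) = 2 * (b - b' / 4)"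
    unfolding c b' by (simp add: divide_simps) (simp add: algebra_simps)
  then have "norm (catalan n) / 4 ^ n = 2 * (b / 4 ^ n - b' / 4 ^ Suc n)"
    by (simp add: field_simps)
  then show ?thesis unfolding b_def b'_def .
qed

lemma catalan_in_l1: "catalan \<in> carrier l1_quarter"
  unfolding l1_quarter_simps
proof (rule summableI_nonneg_bounded)
  fix n :: nat
  show "0 \<le> norm (catalan n) / 4 ^ n" by simp
  \<comment> \<open>The telescoping sum starts from 1, the central binomial coefficient at index 0,
    so 2 bounds all partial sums.\<close>
  have "(\<Sum>i<n. norm (catalan i) / 4 ^ i) = 2 * (1 - real ((2 * n) choose n) / 4 ^ n)"
    by (induction n) (simp_all only: sum.lessThan_Suc catalan_telescope, simp_all)
  also have "\<dots> \<le> 2" by simp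
  finally show "(\<Sum>i<n. norm (catalan i) / 4 ^ i) \<le> 2" .
qed

lemma fps_catalan: "Abs_fps catalan * (1 - fps_X * Abs_fps catalan) = 1"
proof -
  define C where "C = Abs_fps catalan"
  define D where "D = 1 - 2 * (fps_X * C)"
  define u :: "complex fps" where "u = 1 - 4 * fps_X"
  define F where "F = D\<^sup>2 * inverse u"
  have "fps_nth u 0 = 1" by (simp add: u_def)
  then have "inverse u * u = 1" by (intro inverse_mult_eq_1) simp
  then have D2: "D\<^sup>2 = u * F" by (simp add: F_def mult_ac)
  have "u \<noteq> 0" using \<open>fps_nth u 0 = 1\<close> by auto
  have D_Suc: "fps_nth D (Suc k) = - 2 * catalan k" for k
    by (simp add: D_def C_def fps_numeral_fps_const)
  have D': "u * fps_deriv D = - 2 * D"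
  proof (rule fps_ext)
    fix n
    have "fps_nth (u * fps_deriv D) n =
        fps_nth (fps_deriv D) n - 4 * (if n = 0 then 0 else fps_nth (fps_deriv D) (n - 1))"
      by (simp add: u_def algebra_simps fps_numeral_fps_const)
    also have "\<dots> = fps_nth (- 2 * D) n"
    proof (cases n)
      case 0
      then show ?thesis by (simp add: D_def C_def catalan_def fps_numeral_fps_const)
    next
      case (Suc m)
      \<comment> \<open>Index \<open>n = Suc m\<close> meets the recurrence: -4(2m+1) + 8(m+1) =
        4.\<close>
      have "fps_nth (fps_deriv D) n - 4 * fps_nth (fps_deriv D) m =
          - 2 * (of_nat (m + 2) * catalan (Suc m)) + 8 * (of_nat m + 1) * catalan m"
        by (simp add: Suc D_Suc algebra_simps)
      also have "\<dots> = - 2 * (- 2 * catalan m)"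
        unfolding catalan_Suc by (simp add: algebra_simps)
      finally show ?thesis by (simp add: Suc D_Suc fps_numeral_fps_const)
    qed
    finally show "fps_nth (u * fps_deriv D) n = fps_nth (- 2 * D) n" .
  qed
  have u': "fps_deriv u = - 4" by (simp add: u_def fps_numeral_fps_const)
  have "2 * D * fps_deriv D = u * fps_deriv F - 4 * F"
    using arg_cong[OF D2, of fps_deriv] by (simp add: u' power2_eq_square algebra_simps)
  then have "u * fps_deriv F = 2 * D * fps_deriv D + 4 * F" by simp
  \<comment> \<open>The extra factor \<open>u\<close> lets \<open>D'\<close> replace
    \<open>u * fps_deriv D\<close> by \<open>- 2 * D\<close>; since \<open>u * F\<close> is the
    square of \<open>D\<close>, the two terms cancel.\<close>
  then have "u * (u * fps_deriv F) = 2 * D * (u * fps_deriv D) + 4 * (u * F)"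
    by (simp add: algebra_simps)
  also have "\<dots> = 0" by (simp add: D' flip: D2) (simp add: power2_eq_square)
  finally have "fps_deriv F = 0" using \<open>u \<noteq> 0\<close> by simp
  then have "F = fps_const (fps_nth F 0)" by (simp add: fps_deriv_eq_0_iff)
  also have "fps_nth F 0 = 1"
    using \<open>fps_nth u 0 = 1\<close> by (simp add: F_def D_def power2_eq_square)
  finally have "D\<^sup>2 = u" by (simp add: D2)
  \<comment> \<open>The square of \<open>D\<close> is 1 - 4 X C (1 - X C); comparing with 1 - 4 X
    leaves a factor 4 X to cancel.\<close>
  then have "4 * fps_X * (C * (1 - fps_X * C)) = 4 * fps_X * 1"
    by (simp add: D_def u_def power2_eq_square algebra_simps)
  then have "C * (1 - fps_X * C) = 1"
    by (subst (asm) mult_cancel_left) simp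
  then show ?thesis by (simp add: C_def)
qed

lemma p_seq_in_l1:
  assumes "norm \<mu> > 1 / 4"
  shows "p_seq \<mu> \<in> carrier l1_quarter"
proof -
  have "(\<lambda>n. norm (p_seq \<mu> n) / 4 ^ n) = (\<lambda>n. (1 / (4 * norm \<mu>)) ^ n)"
    by (auto simp: p_seq_def norm_divide norm_power power_divide power_mult_distrib)
  moreover have "norm (1 / (4 * norm \<mu>)) < 1"
    using assms by (simp add: norm_divide norm_mult divide_less_eq_1)
  ultimately show ?thesis by (simp only: l1_quarter_simps summable_geometric)
qed

text \<open>Geometric series. At \<open>\<mu> = 0\<close> the convention 1/0 = 0 makes both factors
  1.\<close>

lemma fps_p_seq: "Abs_fps (p_seq \<mu>) * (1 - fps_const (1 / \<mu>) * fps_X) = 1"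
proof (rule fps_ext)
  fix n
  have "Abs_fps (p_seq \<mu>) * (1 - fps_const (1 / \<mu>) * fps_X) =
      Abs_fps (p_seq \<mu>) - fps_const (1 / \<mu>) * (fps_X * Abs_fps (p_seq \<mu>))"
    by (simp add: algebra_simps)
  then show "fps_nth (Abs_fps (p_seq \<mu>) * (1 - fps_const (1 / \<mu>) * fps_X)) n = fps_nth 1 n"
    by (cases n) (simp_all add: p_seq_def)
qed

text \<open>Reduces inversion to an identity of power series, since \<open>Abs_fps\<close> is
  injective and multiplicative. Membership of \<open>b\<close> is assumed because a formal inverse
  may have infinite norm.\<close>

lemma l1_quarter_unit_inv:
  assumes "a \<in> carrier l1_quarter" "b \<in> carrier l1_quarter" "Abs_fps a * Abs_fps b = 1"
  shows "a \<in> Units l1_quarter \<and> inv\<^bsub>l1_quarter\<^esub> a = b"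
proof -
  interpret cring l1_quarter by (rule cring_l1_quarter)
  have "a \<otimes>\<^bsub>l1_quarter\<^esub> b = \<one>\<^bsub>l1_quarter\<^esub>"
    using assms(3) by (simp add: l1_quarter_simps Abs_fps_inject' Abs_fps_conv Abs_fps_delta_0)
  then show ?thesis
    using assms(1,2) comm_inv_char m_comm[of a b] unfolding Units_def by auto
qed

lemma Abs_fps_add: "Abs_fps (\<lambda>n. a n + b n) = Abs_fps a + Abs_fps b"
  by (simp add: fps_eq_iff)

lemma Abs_fps_diff: "Abs_fps (\<lambda>n. a n - b n) = Abs_fps a - Abs_fps (b :: nat \<Rightarrow> complex)"
  by (simp add: fps_eq_iff)

lemma Abs_fps_smult: "Abs_fps (\<lambda>n. c * a n) = fps_const c * Abs_fps (a :: nat \<Rightarrow> complex)"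
  by (simp add: fps_eq_iff)

lemma Abs_fps_delta_1: "Abs_fps (delta 1) = fps_X"
  by (simp add: fps_eq_iff delta_def)

text \<open>A division-free form of the resolvent formula, with \<open>w\<close>, \<open>v\<close>,
  \<open>m\<close> standing for 1/z, 1/(z-1), z^2/(z-1). It thus applies in the domain of power
  series.\<close>

lemma resolvent_identity:
  fixes z v w m x C P :: "'a :: idom"
  assumes C: "C * (1 - x * C) = 1" and P: "P * (1 - m * x) = 1"
    and z: "w * z = 1" "m * (z - 1) = z\<^sup>2" "v * (z - 1) = 1"
  shows "(z - C) * (w + w * v * P + w\<^sup>2 * C - w\<^sup>2 * (C * P)) = 1"
proof -
  let ?R = "w + w * v * P + w\<^sup>2 * C - w\<^sup>2 * (C * P)" and ?q = "1 - m * x"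
    and ?S = "1 - z * x - x * C"
  have "m = v * (m * (z - 1))" using z(3) by (metis mult.left_commute mult.right_neutral)
  then have m: "m = v * z\<^sup>2" by (simp only: z(2))
  have wm: "w * m = v * z"
  proof -
    have "w * m = (w * z) * (v * z)" unfolding m by (simp add: power2_eq_square mult_ac)
    then show ?thesis by (simp add: z(1))
  qed
  have wwm: "w\<^sup>2 * m = v"
  proof -
    have "w\<^sup>2 * m = v * (w * z)\<^sup>2" unfolding m by (simp add: power2_eq_square mult_ac)
    then show ?thesis by (simp add: z(1))
  qed
  have wv: "w + w * v = v"
  proof -
    have "w + w * v = w * (v * (z - 1) + v)" unfolding z(3) by (simp add: algebra_simps)
    also have "\<dots> = v * (w * z)" by (simp add: algebra_simps)
    finally show ?thesis by (simp add: z(1))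
  qed
  \<comment> \<open>Multiplying by \<open>?q\<close> eliminates \<open>P\<close>; the coefficients
    of 1, \<open>x\<close> and \<open>x * C\<close> become \<open>v\<close>, \<open>- v * z\<close>
    and \<open>- v\<close>.\<close>
  have "?R * ?q = w * ?q + w * v * (P * ?q) + w\<^sup>2 * C * ?q - w\<^sup>2 * C * (P * ?q)"
    by (simp add: algebra_simps)
  also have "\<dots> = (w + w * v) - (w * m) * x - (w\<^sup>2 * m) * (x * C)"
    unfolding P by (simp add: algebra_simps)
  also have "\<dots> = v * ?S"
    unfolding wm wwm wv by (simp add: algebra_simps)
  finally have R: "?R * ?q = v * ?S" .
  \<comment> \<open>The mixed terms \<open>z * x * C\<close> cancel, leaving the Catalan equation
    \<open>C\<close> to be used.\<close>
  have "(z - C) * ?S = z - z\<^sup>2 * x - C * (1 - x * C)"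
    by (simp add: algebra_simps power2_eq_square)
  also have "\<dots> = (z - 1) * ?q"
    unfolding C z(2)[symmetric] by (simp add: algebra_simps)
  finally have S: "(z - C) * ?S = (z - 1) * ?q" .
  have "(z - C) * ?R * ?q = (z - C) * (?R * ?q)" by (rule mult.assoc)
  also have "\<dots> = v * ((z - C) * ?S)" unfolding R by (rule mult.left_commute)
  also have "\<dots> = (v * (z - 1)) * ?q" by (simp only: S mult.assoc)
  finally have "(z - C) * ?R * ?q = 1 * ?q" by (simp only: z(3))
  moreover have "?q \<noteq> 0" using P by auto
  ultimately show ?thesis by (simp only: mult_cancel_right) simp
qed

theorem theorem3p4:
  shows "catalan \<in> Units l1_quarter \<and>
    inv\<^bsub>l1_quarter\<^esub> catalan =
      delta 0 \<ominus>\<^bsub>l1_quarter\<^esub> delta 1 \<otimes>\<^bsub>l1_quarter\<^esub> catalan \<and>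
    (\<forall>z::complex. z \<noteq> 0 \<and> norm ((z - 1) / z\<^sup>2) > 1 / 4 \<longrightarrow>
      z \<odot>\<^bsub>l1_quarter\<^esub> delta 0 \<ominus>\<^bsub>l1_quarter\<^esub> catalan \<in> Units l1_quarter \<and>
      inv\<^bsub>l1_quarter\<^esub> (z \<odot>\<^bsub>l1_quarter\<^esub> delta 0 \<ominus>\<^bsub>l1_quarter\<^esub> catalan) =
        (1 / z) \<odot>\<^bsub>l1_quarter\<^esub> delta 0
        \<oplus>\<^bsub>l1_quarter\<^esub> (1 / (z * (z - 1))) \<odot>\<^bsub>l1_quarter\<^esub> p_seq ((z - 1) / z\<^sup>2)
        \<oplus>\<^bsub>l1_quarter\<^esub> (1 / z\<^sup>2) \<odot>\<^bsub>l1_quarter\<^esub> catalan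
        \<ominus>\<^bsub>l1_quarter\<^esub> (1 / z\<^sup>2) \<odot>\<^bsub>l1_quarter\<^esub>
            (catalan \<otimes>\<^bsub>l1_quarter\<^esub> p_seq ((z - 1) / z\<^sup>2)))"
proof (intro conjI allI impI)
  let ?R = l1_quarter
  interpret cring ?R by (rule cring_l1_quarter)
  note closed = catalan_in_l1 delta_in_l1 conv_in_l1 add_in_l1 smult_in_l1
  note to_fps = Abs_fps_add Abs_fps_diff Abs_fps_smult Abs_fps_conv Abs_fps_delta_0 Abs_fps_delta_1

  have 1: "delta 0 \<ominus>\<^bsub>?R\<^esub> delta 1 \<otimes>\<^bsub>?R\<^esub> catalan = (\<lambda>n. delta 0 n - conv (delta 1) catalan n)"
    by (simp only: l1_quarter_simps(2-) minus_l1_quarter closed)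
  have "Abs_fps catalan * Abs_fps (delta 0 \<ominus>\<^bsub>?R\<^esub> delta 1 \<otimes>\<^bsub>?R\<^esub> catalan) = 1"
    unfolding 1 to_fps by (rule fps_catalan)
  moreover have "delta 0 \<ominus>\<^bsub>?R\<^esub> delta 1 \<otimes>\<^bsub>?R\<^esub> catalan \<in> carrier ?R"
    by (intro minus_closed m_closed closed)
  ultimately show "catalan \<in> Units ?R"
      "inv\<^bsub>?R\<^esub> catalan = delta 0 \<ominus>\<^bsub>?R\<^esub> delta 1 \<otimes>\<^bsub>?R\<^esub> catalan"
    using l1_quarter_unit_inv catalan_in_l1 by blast+

  fix z :: complex
  assume z: "z \<noteq> 0 \<and> norm ((z - 1) / z\<^sup>2) > 1 / 4"
  \<comment> \<open>At \<open>z = 1\<close> the norm in the assumption would be 0.\<close>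
  then have "z \<noteq> 1" by auto
  let ?p = "p_seq ((z - 1) / z\<^sup>2)"
  let ?a = "z \<odot>\<^bsub>?R\<^esub> delta 0 \<ominus>\<^bsub>?R\<^esub> catalan"
  let ?b = "(1 / z) \<odot>\<^bsub>?R\<^esub> delta 0 \<oplus>\<^bsub>?R\<^esub> (1 / (z * (z - 1))) \<odot>\<^bsub>?R\<^esub> ?p
    \<oplus>\<^bsub>?R\<^esub> (1 / z\<^sup>2) \<odot>\<^bsub>?R\<^esub> catalan \<ominus>\<^bsub>?R\<^esub> (1 / z\<^sup>2) \<odot>\<^bsub>?R\<^esub> (catalan \<otimes>\<^bsub>?R\<^esub> ?p)"
  have p: "?p \<in> carrier ?R" using z by (intro p_seq_in_l1) simp
  have a: "?a = (\<lambda>n. z * delta 0 n - catalan n)"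
    by (simp only: l1_quarter_simps(2-) minus_l1_quarter closed)
  have b: "?b = (\<lambda>n. 1 / z * delta 0 n + 1 / (z * (z - 1)) * ?p n + 1 / z\<^sup>2 * catalan n
      - 1 / z\<^sup>2 * conv catalan ?p n)"
    by (simp only: l1_quarter_simps(2-) minus_l1_quarter closed p)
  have a_in: "?a \<in> carrier ?R"
    unfolding l1_quarter_simps(6) by (intro minus_closed closed)
  have b_in: "?b \<in> carrier ?R"
    unfolding l1_quarter_simps(6) by (intro minus_closed a_closed m_closed closed p)
  let ?c = "fps_const :: complex \<Rightarrow> complex fps"
  \<comment> \<open>Scalars enter as constant series, and 1/(z(z-1)) is split into two factors to
    match \<open>w * v\<close>.\<close>
  have "(?c z - Abs_fps catalan) * (?c (1 / z) + ?c (1 / z) * ?c (1 / (z - 1)) * Abs_fps ?p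
      + (?c (1 / z))\<^sup>2 * Abs_fps catalan - (?c (1 / z))\<^sup>2 * (Abs_fps catalan * Abs_fps ?p)) = 1"
  proof (rule resolvent_identity[OF fps_catalan fps_p_seq])
    have c1: "?c z - 1 = ?c (z - 1)" by (simp flip: fps_const_sub)
    show "?c (1 / z) * ?c z = 1" using z by simp
    show "?c (1 / ((z - 1) / z\<^sup>2)) * (?c z - 1) = (?c z)\<^sup>2"
      unfolding c1 using \<open>z \<noteq> 1\<close> by (simp add: power2_eq_square)
    show "?c (1 / (z - 1)) * (?c z - 1) = 1"
      unfolding c1 using \<open>z \<noteq> 1\<close> by simp
  qed
  then have "Abs_fps ?a * Abs_fps ?b = 1"
    unfolding a b to_fps by (simp add: power2_eq_square)
  then show "?a \<in> Units ?R" "inv\<^bsub>?R\<^esub> ?a = ?b"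
    using l1_quarter_unit_inv[OF a_in b_in] by blast+
qed

end
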